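(* Let $\mu,\kappa,\lambda$ be infinite cardinals, let $I,I'$ be sets, and let $D\subseteq\mathcal P(I)$ and $D'\subseteq\mathcal P(I')$. If $\Phi(\mu,\kappa,\lambda)$ holds, $D'$ is $\mu$-decomposable, and $D$ is $\lambda$-decomposable, then $D\times D'$ is $\kappa$-decomposable.
   Context: Notation: for a set $S$ and a cardinal $\nu$, $[S]^{\nu}=\{Z\subseteq S : |Z|=\nu\}$ and $[S]^{<\nu}=\{Z\subseteq S : |Z|<\nu\}$; $\mathcal P(I)$ is the set of all subsets of $I$. The families $D,D'$ are arbitrary families of subsets; they are not assumed to be filters or ultrafilters. Principle $\Phi(\mu,\kappa,\lambda)$ (for infinite cardinals, $\lambda$ not assumed regular): there exists a family $\{S_\xi : \xi<\lambda\}\subseteq[\kappa]^{\mu}$ (indexed by $\xi<\lambda$) such that $|\{\xi<\lambda : |A\cap S_\xi|=\mu\}|<\lambda$ for every $A\in[\kappa]^{<\kappa}$. For an infinite cardinal $\nu$, a family $E\subseteq\mathcal P(J)$ is $\nu$-decomposable if there is a function $f:J\to\nu$ such that $f^{-1}(Z)\notin E$ whenever $Z\in[\nu]^{<\nu}$. The product $D\times D'\subseteq\mathcal P(I\times I')$ is defined by: $X\in D\times D'$ if and only if $\{i\in I : \{i'\in I' : (i,i')\in X\}\in D'\}\in D$. *)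

theory Defs
  imports Main
begin

unbundle cardinal_syntax

text \<open>
  Cardinals are rendered by the library's cardinal orders: an infinite cardinal is a relation
  \<open>r\<close> with \<open>Cinfinite r\<close>, and the set of ordinals below it is represented by \<open>Field r\<close>.
\<close>

definition subsets_eq :: "'a set \<Rightarrow> 'b rel \<Rightarrow> 'a set set" where
  "subsets_eq S \<nu> = {Z. Z \<subseteq> S \<and> |Z| =o \<nu>}"

definition subsets_less :: "'a set \<Rightarrow> 'b rel \<Rightarrow> 'a set set" where
  "subsets_less S \<nu> = {Z. Z \<subseteq> S \<and> |Z| <o \<nu>}"

definition Phi :: "'m rel \<Rightarrow> 'k rel \<Rightarrow> 'l rel \<Rightarrow> bool" where
  "Phi \<mu> \<kappa> \<Lambda> \<longleftrightarrow>
     (\<exists>S :: 'l \<Rightarrow> 'k set.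
        (\<forall>\<xi>\<in>Field \<Lambda>. S \<xi> \<in> subsets_eq (Field \<kappa>) \<mu>) \<and>
        (\<forall>A\<in>subsets_less (Field \<kappa>) \<kappa>. |{\<xi>\<in>Field \<Lambda>. |A \<inter> S \<xi>| =o \<mu>}| <o \<Lambda>))"

text \<open>The index set \<open>J\<close> is an argument because preimages are taken within \<open>J\<close>.\<close>

definition decomposable :: "'n rel \<Rightarrow> 'j set \<Rightarrow> 'j set set \<Rightarrow> bool" where
  "decomposable \<nu> J E \<longleftrightarrow>
     (\<exists>f. f ` J \<subseteq> Field \<nu> \<and> (\<forall>Z\<in>subsets_less (Field \<nu>) \<nu>. {j\<in>J. f j \<in> Z} \<notin> E))"

definition family_prod ::
  "'i set \<Rightarrow> 'i set set \<Rightarrow> 'j set \<Rightarrow> 'j set set \<Rightarrow> ('i \<times> 'j) set set" where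
  "family_prod I D I' D' =
     {X. X \<subseteq> I \<times> I' \<and> {i\<in>I. {i'\<in>I'. (i, i') \<in> X} \<in> D'} \<in> D}"

end

theory Submission
  imports Defs
begin

text \<open>
  Let \<open>f\<close> and \<open>f'\<close> decompose \<open>D\<close> and \<open>D'\<close>, and let \<open>h \<xi>\<close> be a bijection from the set underlying
  \<open>\<mu>\<close> onto the member \<open>S \<xi>\<close> of the family given by \<open>Phi\<close>. The product is decomposed by
  \<open>g (i, i') = h (f i) (f' i')\<close>: the first coordinate chooses a set \<open>S \<xi>\<close>, the second a point of it.

  Suppose \<open>A\<close> has fewer than \<open>\<kappa>\<close> elements. The section at \<open>i\<close> of the \<open>g\<close>-preimage of \<open>A\<close> is the
  \<open>f'\<close>-preimage of a set equinumerous with \<open>A \<inter> S (f i)\<close>, so it can lie in \<open>D'\<close> only if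
  \<open>A \<inter> S (f i)\<close> has full size \<open>\<mu>\<close>. Moreover the section depends on \<open>i\<close> only through \<open>f i\<close>. Hence the
  set of those \<open>i\<close> whose section lies in \<open>D'\<close> is exactly the \<open>f\<close>-preimage of a set of indices \<open>\<xi>\<close>
  contained in the set that \<open>Phi\<close> bounds below \<open>\<Lambda>\<close>. Being such a preimage, and not merely a subset
  of one, it is not in \<open>D\<close>, even though \<open>D\<close> need not be closed under supersets.
\<close>

lemma card_of_bij_betw_Int:
  assumes "bij_betw h M S"
  shows "|{m \<in> M. h m \<in> A}| =o |A \<inter> S|"
proof -
  have "bij_betw h {m \<in> M. h m \<in> A} (A \<inter> S)"
    using assms by (fastforce simp: bij_betw_def inj_on_def)
  then show ?thesis
    by (rule card_of_ordIsoI)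
qed

lemma card_of_subset_Field_ordLess:
  assumes "Card_order r" "Z \<subseteq> Field r" "\<not> |Z| =o r"
  shows "|Z| <o r"
proof -
  have "|Z| \<le>o r"
    using card_of_mono1[OF assms(2)] card_of_Field_ordIso[OF assms(1)]
    by (rule ordLeq_ordIso_trans)
  then show ?thesis
    using assms(3) by (simp add: ordLeq_iff_ordLess_or_ordIso)
qed

theorem theorem3p1:
  fixes \<mu> :: "'m rel" and \<kappa> :: "'k rel" and \<Lambda> :: "'l rel"
    and I :: "'i set" and I' :: "'j set"
    and D :: "'i set set" and D' :: "'j set set"
  assumes "Cinfinite \<mu>" and "Cinfinite \<kappa>" and "Cinfinite \<Lambda>"
    and "D \<subseteq> Pow I" and "D' \<subseteq> Pow I'"
    and "Phi \<mu> \<kappa> \<Lambda>"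
    and "decomposable \<mu> I' D'"
    and "decomposable \<Lambda> I D"
  shows "decomposable \<kappa> (I \<times> I') (family_prod I D I' D')"
proof -
  have card_\<mu>: "Card_order \<mu>"
    using assms(1) by simp
  obtain S :: "'l \<Rightarrow> 'k set" where
    S: "\<And>\<xi>. \<xi> \<in> Field \<Lambda> \<Longrightarrow> S \<xi> \<subseteq> Field \<kappa> \<and> |S \<xi>| =o \<mu>" and
    few: "\<And>A. A \<in> subsets_less (Field \<kappa>) \<kappa> \<Longrightarrow> |{\<xi>\<in>Field \<Lambda>. |A \<inter> S \<xi>| =o \<mu>}| <o \<Lambda>"
    using assms(6) unfolding Phi_def subsets_eq_def by blast
  obtain f' where f': "f' ` I' \<subseteq> Field \<mu>"
    "\<And>Z. Z \<in> subsets_less (Field \<mu>) \<mu> \<Longrightarrow> {j\<in>I'. f' j \<in> Z} \<notin> D'"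
    using assms(7) unfolding decomposable_def by blast
  obtain f where f: "f ` I \<subseteq> Field \<Lambda>"
    "\<And>Z. Z \<in> subsets_less (Field \<Lambda>) \<Lambda> \<Longrightarrow> {i\<in>I. f i \<in> Z} \<notin> D"
    using assms(8) unfolding decomposable_def by blast
  have "\<exists>h. bij_betw h (Field \<mu>) (S \<xi>)" if "\<xi> \<in> Field \<Lambda>" for \<xi>
  proof -
    have "|S \<xi>| =o \<mu>"
      using S that by blast
    then have "|Field \<mu>| =o |S \<xi>|"
      using card_of_Field_ordIso[OF card_\<mu>] ordIso_symmetric ordIso_transitive by blast
    then show ?thesis
      by (simp add: card_of_ordIso)
  qed
  then obtain h where h: "\<And>\<xi>. \<xi> \<in> Field \<Lambda> \<Longrightarrow> bij_betw (h \<xi>) (Field \<mu>) (S \<xi>)"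
    by metis
  define g where "g = (\<lambda>(i, i'). h (f i) (f' i'))"
  have "g ` (I \<times> I') \<subseteq> Field \<kappa>"
    using S f(1) f'(1) h unfolding g_def by (fastforce simp: bij_betw_def)
  moreover have "{p \<in> I \<times> I'. g p \<in> A} \<notin> family_prod I D I' D'"
    if A: "A \<in> subsets_less (Field \<kappa>) \<kappa>" for A
  proof -
    define B where "B = {\<xi> \<in> Field \<Lambda>. {i' \<in> I'. h \<xi> (f' i') \<in> A} \<in> D'}"
    have "|A \<inter> S \<xi>| =o \<mu>" if "\<xi> \<in> B" for \<xi>
    proof (rule ccontr)
      assume small: "\<not> |A \<inter> S \<xi>| =o \<mu>"
      let ?Z = "{m \<in> Field \<mu>. h \<xi> m \<in> A}"
      have \<xi>: "\<xi> \<in> Field \<Lambda>" "{i' \<in> I'. h \<xi> (f' i') \<in> A} \<in> D'"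
        using that by (auto simp: B_def)
      have "\<not> |?Z| =o \<mu>"
        using card_of_bij_betw_Int[OF h[OF \<xi>(1)]] small ordIso_symmetric ordIso_transitive
        by blast
      then have "?Z \<in> subsets_less (Field \<mu>) \<mu>"
        using card_of_subset_Field_ordLess[OF card_\<mu>, of ?Z] by (auto simp: subsets_less_def)
      then have "{i' \<in> I'. f' i' \<in> ?Z} \<notin> D'"
        by (rule f'(2))
      moreover have "{i' \<in> I'. f' i' \<in> ?Z} = {i' \<in> I'. h \<xi> (f' i') \<in> A}"
        using f'(1) by auto
      ultimately show False
        using \<xi>(2) by simp
    qed
    then have "B \<subseteq> {\<xi>\<in>Field \<Lambda>. |A \<inter> S \<xi>| =o \<mu>}"
      by (auto simp: B_def)
    then have "|B| <o \<Lambda>"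
      using few[OF A] card_of_mono1 ordLeq_ordLess_trans by blast
    then have "B \<in> subsets_less (Field \<Lambda>) \<Lambda>"
      by (auto simp: subsets_less_def B_def)
    then have "{i \<in> I. f i \<in> B} \<notin> D"
      by (rule f(2))
    moreover have "{i \<in> I. {i' \<in> I'. (i, i') \<in> {p \<in> I \<times> I'. g p \<in> A}} \<in> D'} = {i \<in> I. f i \<in> B}"
      using f(1) by (auto simp: B_def g_def cong: conj_cong)
    ultimately show ?thesis
      by (simp add: family_prod_def)
  qed
  ultimately show ?thesis
    unfolding decomposable_def by blast
qed

end
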